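(* Let $\Phi(r,q)=r^2\psi''(r+1-q)+2r\psi'(r+1-q)$. (a) If $q\in(-\infty,0]\cup[1,\infty)$, then for all real $r>q$, $$\Phi(r,q)=r^2\psi''(r+1-q)+2r\psi'(r+1-q)<1.$$ (b) When $q=\tfrac23$, for all real $r>\tfrac23$, $$\Phi\left(r,\tfrac23\right)=r^2\psi''\left(r+\tfrac13\right)+2r\psi'\left(r+\tfrac13\right)>1.$$
   Context: $\psi(r)=\Gamma'(r)/\Gamma(r)$ denotes the digamma function; $\psi',\psi''$ are its first and second derivatives. *)

theory Defs
  imports "HOL-Analysis.Analysis"
begin

text \<open>
  \<^const>\<open>Digamma\<close> is introduced in the library by a series; on the positive reals it is the
  logarithmic derivative of \<^const>\<open>Gamma\<close>.
\<close>

lemma Digamma_eq_deriv_Gamma_over_Gamma: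
  fixes x :: real
  assumes "x > 0"
  shows "Digamma x = deriv Gamma x / Gamma x"
proof -
  have "x \<notin> \<int>\<^sub>\<le>\<^sub>0" using assms by (auto elim!: nonpos_Ints_cases)
  then have "(Gamma has_field_derivative Gamma x * Digamma x) (at x)"
    by (rule has_field_derivative_Gamma)
  then have "deriv Gamma x = Gamma x * Digamma x"
    by (rule DERIV_imp_deriv)
  then show ?thesis using Gamma_real_pos[OF assms] by simp
qed

definition Phi :: "real \<Rightarrow> real \<Rightarrow> real" where
  "Phi r q = r\<^sup>2 * deriv (deriv Digamma) (r + 1 - q) + 2 * r * deriv Digamma (r + 1 - q)"

end

theory Submission
  imports Defs "HOL-Real_Asymp.Real_Asymp"
begin

text \<open>
  Write \<open>x = r + 1 - q\<close>, so that \<open>x > 1\<close> corresponds to \<open>r > q\<close>, and put \<open>S = \<psi>'(x) > 0\<close> and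
  \<open>T = - \<psi>''(x) > 0\<close>. Then \<open>\<Phi>(r,q) = 2 r S - r\<^sup>2 T\<close>: for a fixed \<open>x\<close> this is a concave parabola in
  \<open>r\<close> with vertex at \<open>S / T\<close>, and asymptotically \<open>S / T \<approx> x - 1/2\<close>. What is needed
  about the vertex is only that it lies between \<open>x - 1\<close> and \<open>x\<close>
  (\<open>polygamma_vertex_between\<close>).

  The values \<open>q \<le> 0\<close> correspond to \<open>r \<le> x - 1\<close>, to the left of the vertex, and the values \<open>q \<ge> 1\<close>
  to \<open>r \<ge> x\<close>, to the right of it. The parabola is therefore largest at \<open>r = x - 1\<close> and \<open>r = x\<close>
  respectively, which are the boundary cases \<open>q = 0\<close> and \<open>q = 1\<close>. These are the same inequality at
  different arguments: the recurrences for \<open>\<psi>'\<close> and \<open>\<psi>''\<close> turn the expression for \<open>q = 0\<close> at \<open>x\<close>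
  into the one for \<open>q = 1\<close> at \<open>x - 1\<close>, because the two rational correction terms cancel. Hence part (a)
  reduces to \<open>y\<^sup>2 \<psi>''(y) + 2 y \<psi>'(y) < 1\<close> for \<open>y > 0\<close>, and proving it at \<open>y = x - 1\<close> with bounds taken
  at \<open>x > 1\<close> avoids the pole at \<open>0\<close>. In part (b), \<open>r = x - 1/3\<close> is close enough to the vertex for the
  leading correction to the limit \<open>1\<close> to be positive.

  All remaining inequalities follow from truncated asymptotic expansions
  \<open>1/x + 1/(2x\<^sup>2) + 1/(6x\<^sup>3) - 1/(30x\<^sup>5) \<le> S \<le> 1/x + 1/(2x\<^sup>2) + 1/(6x\<^sup>3)\<close> and
  \<open>1/x\<^sup>2 + 1/x\<^sup>3 + 1/(2x\<^sup>4) - 1/(6x\<^sup>6) \<le> T \<le> 1/x\<^sup>2 + 1/x\<^sup>3 + 1/(2x\<^sup>4)\<close>. Since \<open>S\<close> and \<open>T\<close> are sums of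
  \<open>1/(x + k)\<^sup>2\<close> and \<open>2/(x + k)\<^sup>3\<close>, such a bound holds as soon as the difference \<open>g(y) - g(y + 1)\<close> of
  the bounding function \<open>g\<close> compares with a single summand, which is an inequality of rational functions.
\<close>

section \<open>Rational bounds for the trigamma and tetragamma functions\<close>

lemma polygamma_sums:
  fixes x :: real
  assumes "x > 0" "n > 0"
  shows "(\<lambda>k. fact n / (x + real k) ^ Suc n) sums ((-1) ^ Suc n * Polygamma n x)"
proof -
  have "(\<lambda>k. fact n * inverse ((x + real k) ^ Suc n)) sums
      (fact n * ((-1) ^ Suc n * Polygamma n x / fact n))"
    using Polygamma_LIMSEQ[of x n] assms by (intro sums_mult) auto
  moreover have "fact n * ((-1) ^ Suc n * Polygamma n x / fact n) = (-1) ^ Suc n * Polygamma n x"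
    by simp
  ultimately show ?thesis
    by (simp only: divide_inverse)
qed

lemma telescoping_shift_sums:
  fixes g :: "real \<Rightarrow> real"
  assumes "(g \<longlongrightarrow> 0) at_top"
  shows "(\<lambda>k. g (x + real k) - g (x + real k + 1)) sums g x"
proof -
  have "filterlim (\<lambda>k. x + real k) at_top sequentially"
    by real_asymp
  with assms have "(\<lambda>k. g (x + real k)) \<longlonglongrightarrow> 0"
    by (rule filterlim_compose)
  from telescope_sums'[OF this] show ?thesis
    by (simp add: add_ac)
qed

text \<open>
  In the next two lemmas the inequality on \<open>g\<close> compares the series of \<open>Polygamma n x\<close> term by term with
  a telescoping series of sum \<open>g x\<close>.
\<close>

lemma polygamma_le_telescope:
  fixes g :: "real \<Rightarrow> real"
  assumes "x > 0" "n > 0" and lim: "(g \<longlongrightarrow> 0) at_top"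
    and step: "\<And>y. y > 0 \<Longrightarrow> fact n / y ^ Suc n \<le> g y - g (y + 1)"
  shows "(-1) ^ Suc n * Polygamma n x \<le> g x"
  by (rule sums_le[OF _ polygamma_sums[OF assms(1,2)] telescoping_shift_sums[OF lim]])
     (use step assms(1) in auto)

lemma telescope_le_polygamma:
  fixes g :: "real \<Rightarrow> real"
  assumes "x > 0" "n > 0" and lim: "(g \<longlongrightarrow> 0) at_top"
    and step: "\<And>y. y > 0 \<Longrightarrow> g y - g (y + 1) \<le> fact n / y ^ Suc n"
  shows "g x \<le> (-1) ^ Suc n * Polygamma n x"
  by (rule sums_le[OF _ telescoping_shift_sums[OF lim] polygamma_sums[OF assms(1,2)]])
     (use step assms(1) in auto)

lemma trigamma_upper:
  fixes x :: real
  assumes "x > 0"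
  shows "Polygamma 1 x \<le> 1/x + 1/(2*x^2) + 1/(6*x^3)"
proof -
  let ?g = "\<lambda>x::real. 1/x + 1/(2*x^2) + 1/(6*x^3)"
  have "fact 1 / y ^ Suc 1 \<le> ?g y - ?g (y + 1)" if y: "y > 0" for y
  proof -
    \<comment> \<open>A separate name for \<open>y + 1\<close> keeps its powers factored while denominators are cleared.\<close>
    have "?g y - ?g z - 1 / y^2 = 1 / (6 * y^3 * z^3)" if "z = y + 1" "z > 0" for z
      using y that(2) by (simp add: divide_simps) (simp add: that(1), algebra)
    from this[of "y + 1"] y have "?g y - ?g (y + 1) - 1 / y^2 \<ge> 0"
      by simp
    then show ?thesis
      by (simp add: power2_eq_square)
  qed
  moreover have "(?g \<longlongrightarrow> 0) at_top"
    by real_asymp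
  ultimately show ?thesis
    using polygamma_le_telescope[of x 1 ?g] assms by simp
qed

lemma trigamma_lower:
  fixes x :: real
  assumes "x > 0"
  shows "1/x + 1/(2*x^2) + 1/(6*x^3) - 1/(30*x^5) \<le> Polygamma 1 x"
proof -
  let ?g = "\<lambda>x::real. 1/x + 1/(2*x^2) + 1/(6*x^3) - 1/(30*x^5)"
  have "?g y - ?g (y + 1) \<le> fact 1 / y ^ Suc 1" if y: "y > 0" for y
  proof -
    have "1 / y^2 - (?g y - ?g z) = (5*y^2 + 5*y + 1) / (30 * y^5 * z^5)"
      if "z = y + 1" "z > 0" for z
      using y that(2) by (simp add: divide_simps) (simp add: that(1), algebra)
    from this[of "y + 1"] y have "1 / y^2 - (?g y - ?g (y + 1)) \<ge> 0"
      by simp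
    then show ?thesis
      by (simp add: power2_eq_square)
  qed
  moreover have "(?g \<longlongrightarrow> 0) at_top"
    by real_asymp
  ultimately show ?thesis
    using telescope_le_polygamma[of x 1 ?g] assms by simp
qed

lemma tetragamma_upper:
  fixes x :: real
  assumes "x > 0"
  shows "- Polygamma 2 x \<le> 1/x^2 + 1/x^3 + 1/(2*x^4)"
proof -
  let ?g = "\<lambda>x::real. 1/x^2 + 1/x^3 + 1/(2*x^4)"
  have "fact 2 / y ^ Suc 2 \<le> ?g y - ?g (y + 1)" if y: "y > 0" for y
  proof -
    have "?g y - ?g z - 2 / y^3 = (2*y + 1) / (2 * y^4 * z^4)" if "z = y + 1" "z > 0" for z
      using y that(2) by (simp add: divide_simps) (simp add: that(1), algebra)
    from this[of "y + 1"] y have "?g y - ?g (y + 1) - 2 / y^3 \<ge> 0"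
      by simp
    then show ?thesis
      by (simp add: eval_nat_numeral)
  qed
  moreover have "(?g \<longlongrightarrow> 0) at_top"
    by real_asymp
  ultimately show ?thesis
    using polygamma_le_telescope[of x 2 ?g] assms by simp
qed

lemma tetragamma_lower:
  fixes x :: real
  assumes "x > 0"
  shows "1/x^2 + 1/x^3 + 1/(2*x^4) - 1/(6*x^6) \<le> - Polygamma 2 x"
proof -
  let ?g = "\<lambda>x::real. 1/x^2 + 1/x^3 + 1/(2*x^4) - 1/(6*x^6)"
  have "?g y - ?g (y + 1) \<le> fact 2 / y ^ Suc 2" if y: "y > 0" for y
  proof -
    have "2 / y^3 - (?g y - ?g z) = (2*y + 1)^3 / (6 * y^6 * z^6)" if "z = y + 1" "z > 0" for z
      using y that(2) by (simp add: divide_simps) (simp add: that(1), algebra)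
    from this[of "y + 1"] y have "2 / y^3 - (?g y - ?g (y + 1)) \<ge> 0"
      by simp
    then show ?thesis
      by (simp add: eval_nat_numeral)
  qed
  moreover have "(?g \<longlongrightarrow> 0) at_top"
    by real_asymp
  ultimately show ?thesis
    using telescope_le_polygamma[of x 2 ?g] assms by simp
qed

section \<open>The parabola in r\<close>

lemma Phi_eq_polygamma:
  assumes "r > q"
  shows "Phi r q = 2 * r * Polygamma 1 (r + 1 - q) - r\<^sup>2 * (- Polygamma 2 (r + 1 - q))"
proof -
  have nz: "r + 1 - q \<notin> \<int>\<^sub>\<le>\<^sub>0"
    using assms by (auto elim!: nonpos_Ints_cases)
  show ?thesis
    using deriv_Polygamma[OF nz, of 0] higher_deriv_Polygamma[OF nz, of 2 0]
    by (simp add: Phi_def numeral_2_eq_2)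
qed

lemma polygamma_vertex_between:
  fixes x :: real
  assumes "x > 1"
  shows "(x - 1) * (- Polygamma 2 x) \<le> Polygamma 1 x"
    and "Polygamma 1 x \<le> x * (- Polygamma 2 x)"
proof -
  have "(x - 1) * (- Polygamma 2 x) \<le> (x - 1) * (1/x^2 + 1/x^3 + 1/(2*x^4))"
    using assms tetragamma_upper[of x] by (intro mult_left_mono) auto
  also have "\<dots> = 1/x + 1/(2*x^2) + 1/(6*x^3) - 1/(30*x^5)
      - (15*x^3 + 20*x^2 + 15*x - 1) / (30*x^5)"
    using assms by (simp add: divide_simps) algebra
  also have "\<dots> \<le> Polygamma 1 x"
  proof -
    have "15*x^3 \<ge> 0" "20*x^2 \<ge> 0" using assms by auto
    then have "0 \<le> 15*x^3 + 20*x^2 + 15*x - 1" using assms by linarith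
    then have "0 \<le> (15*x^3 + 20*x^2 + 15*x - 1) / (30*x^5)" using assms by simp
    then show ?thesis using trigamma_lower[of x] assms by linarith
  qed
  finally show "(x - 1) * (- Polygamma 2 x) \<le> Polygamma 1 x" .
next
  have "x * (1/x^2 + 1/x^3 + 1/(2*x^4) - 1/(6*x^6)) - (1/x + 1/(2*x^2) + 1/(6*x^3))
      = (3*x^3 + 2*x^2 - 1) / (6*x^5)"
    using assms by (simp add: divide_simps) algebra
  moreover have "(3*x^3 + 2*x^2 - 1) / (6*x^5) \<ge> 0"
  proof -
    have "1 \<le> x^3" "1 \<le> x^2" using assms by auto
    then show ?thesis using assms by (intro divide_nonneg_nonneg) (linarith | simp)+
  qed
  ultimately have "Polygamma 1 x \<le> x * (1/x^2 + 1/x^3 + 1/(2*x^4) - 1/(6*x^6))"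
    using trigamma_upper[of x] assms by linarith
  also have "\<dots> \<le> x * (- Polygamma 2 x)"
    using assms tetragamma_lower[of x] by (intro mult_left_mono) auto
  finally show "Polygamma 1 x \<le> x * (- Polygamma 2 x)" .
qed

text \<open>
  The alternatives in the second hypothesis say, without dividing by \<open>T\<close>, that \<open>b\<close> lies between \<open>a\<close> and
  the vertex \<open>S / T\<close>; a concave parabola increases towards its vertex on either side.
\<close>

lemma concave_parabola_le:
  fixes a b S T :: real
  assumes "T \<ge> 0" "(a \<le> b \<and> b * T \<le> S) \<or> (b \<le> a \<and> S \<le> b * T)"
  shows "2 * a * S - a\<^sup>2 * T \<le> 2 * b * S - b\<^sup>2 * T"
proof -
  have "2 * b * S - b\<^sup>2 * T - (2 * a * S - a\<^sup>2 * T)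
      = 2 * ((b - a) * (S - b * T)) + (b - a)\<^sup>2 * T"
    by (simp add: algebra_simps power2_eq_square)
  moreover have "(b - a) * (S - b * T) \<ge> 0"
    using assms(2) by (auto simp: zero_le_mult_iff)
  moreover have "(b - a)\<^sup>2 * T \<ge> 0"
    using assms(1) by simp
  ultimately show ?thesis by linarith
qed

section \<open>The parameters 0, 1 and 2/3\<close>

text \<open>The case \<open>q = 0\<close>: here \<open>r = x - 1\<close> for the argument \<open>x\<close> of the polygamma functions.\<close>

lemma polygamma_parabola_less_1_shifted:
  fixes x :: real
  assumes "x > 1"
  shows "2 * (x - 1) * Polygamma 1 x - (x - 1)\<^sup>2 * (- Polygamma 2 x) < 1"
proof -
  have "2 * (x - 1) * Polygamma 1 x \<le> 2 * (x - 1) * (1/x + 1/(2*x^2) + 1/(6*x^3))"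
    using assms trigamma_upper[of x] by (intro mult_left_mono) auto
  moreover have "(x - 1)\<^sup>2 * (1/x^2 + 1/x^3 + 1/(2*x^4) - 1/(6*x^6)) \<le> (x - 1)\<^sup>2 * (- Polygamma 2 x)"
    using assms tetragamma_lower[of x] by (intro mult_left_mono) auto
  moreover have "1 - (2 * (x - 1) * (1/x + 1/(2*x^2) + 1/(6*x^3))
        - (x - 1)\<^sup>2 * (1/x^2 + 1/x^3 + 1/(2*x^4) - 1/(6*x^6)))
      = (x^4 + 2*x^3 + 2*x^2 + 2*x - 1) / (6*x^6)"
    using assms by (simp add: divide_simps) algebra
  moreover have "(x^4 + 2*x^3 + 2*x^2 + 2*x - 1) / (6*x^6) > 0"
  proof -
    have "x^4 > 0" "x^3 > 0" "x^2 > 0" using assms by auto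
    then show ?thesis using assms by (intro divide_pos_pos) (linarith | simp)+
  qed
  ultimately show ?thesis by linarith
qed

text \<open>
  The case \<open>q = 1\<close>. Passing from \<open>y\<close> to \<open>y + 1\<close> subtracts \<open>1 / y\<^sup>2\<close> from \<open>\<psi>'\<close> and adds \<open>2 / y\<^sup>3\<close>
  to \<open>\<psi>''\<close>, which changes \<open>2 y \<psi>' + y\<^sup>2 \<psi>''\<close> by \<open>- 2 / y + 2 / y = 0\<close>.
\<close>

lemma polygamma_parabola_less_1:
  fixes y :: real
  assumes "y > 0"
  shows "2 * y * Polygamma 1 y - y\<^sup>2 * (- Polygamma 2 y) < 1"
proof -
  have P1: "Polygamma 1 (y + 1) = Polygamma 1 y - 1 / y^2"
    using Polygamma_plus1[of y 1] assms by (simp add: power2_eq_square)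
  have P2: "Polygamma 2 (y + 1) = Polygamma 2 y + 2 / y^3"
    using Polygamma_plus1[of y 2] assms by (simp add: eval_nat_numeral)
  have "2 * y * (p - 1 / y^2) - y\<^sup>2 * (- (t + 2 / y^3)) = 2 * y * p - y\<^sup>2 * (- t)" for p t
    using assms by (simp add: field_simps eval_nat_numeral)
  then show ?thesis
    using polygamma_parabola_less_1_shifted[of "y + 1"] assms unfolding P1 P2 by simp
qed

text \<open>
  With \<open>r = x - c\<close> the asymptotic expansion of \<open>\<Phi>\<close> is \<open>1 + (c - c\<^sup>2 - 1/6) / x\<^sup>2 + \<dots>\<close>; for \<open>c = 1/3\<close>
  the coefficient is \<open>1/18 > 0\<close>, which leaves room for the truncated expansions.
\<close>

lemma polygamma_parabola_greater_1:
  fixes x :: real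
  assumes "x > 1"
  shows "2 * (x - 1/3) * Polygamma 1 x - (x - 1/3)\<^sup>2 * (- Polygamma 2 x) > 1"
proof -
  have "2 * (x - 1/3) * Polygamma 1 x \<ge> 2 * (x - 1/3) * (1/x + 1/(2*x^2) + 1/(6*x^3) - 1/(30*x^5))"
    using assms trigamma_lower[of x] by (intro mult_left_mono) auto
  moreover have "(x - 1/3)\<^sup>2 * (1/x^2 + 1/x^3 + 1/(2*x^4)) \<ge> (x - 1/3)\<^sup>2 * (- Polygamma 2 x)"
    using assms tetragamma_upper[of x] by (intro mult_left_mono) auto
  moreover have "2 * (x - 1/3) * (1/x + 1/(2*x^2) + 1/(6*x^3) - 1/(30*x^5))
        - (x - 1/3)\<^sup>2 * (1/x^2 + 1/x^3 + 1/(2*x^4)) - 1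
      = (5*x^3 + 10*x^2 - 11*x + 2) / (90*x^5)"
    using assms by (simp add: divide_simps) algebra
  moreover have "(5*x^3 + 10*x^2 - 11*x + 2) / (90*x^5) > 0"
  proof -
    have "x \<le> x^2" "x \<le> x^3"
      using assms power_increasing[of 1 2 x] power_increasing[of 1 3 x] by auto
    then show ?thesis using assms by (intro divide_pos_pos) (linarith | simp)+
  qed
  ultimately show ?thesis by linarith
qed

theorem theorem1p20:
  shows "(\<forall>q::real. q \<in> {..0} \<union> {1..} \<longrightarrow> (\<forall>r::real. r > q \<longrightarrow> Phi r q < 1)) \<and>
         (\<forall>r::real. r > 2/3 \<longrightarrow> Phi r (2/3) > 1)"
proof (intro conjI allI impI)
  fix q r :: real
  assume q: "q \<in> {..0} \<union> {1..}" and r: "r > q"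
  define x where "x = r + 1 - q"
  define S where "S = Polygamma 1 x"
  define T where "T = - Polygamma 2 x"
  have x: "x > 1" using r by (simp add: x_def)
  have V: "(x - 1) * T \<le> S" "S \<le> x * T"
    using polygamma_vertex_between[OF x] by (simp_all add: S_def T_def)
  then have T: "T \<ge> 0" by (simp add: algebra_simps)
  have "2 * r * S - r\<^sup>2 * T < 1"
  proof (cases "q \<le> 0")
    case True
    then have "2 * r * S - r\<^sup>2 * T \<le> 2 * (x - 1) * S - (x - 1)\<^sup>2 * T"
      using V T by (intro concave_parabola_le) (auto simp: x_def)
    also have "\<dots> < 1"
      using polygamma_parabola_less_1_shifted[OF x] by (simp add: S_def T_def)
    finally show ?thesis .
  next
    case False
    then have "2 * r * S - r\<^sup>2 * T \<le> 2 * x * S - x\<^sup>2 * T"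
      using V T q by (intro concave_parabola_le) (auto simp: x_def)
    also have "\<dots> < 1"
      using polygamma_parabola_less_1[of x] x by (simp add: S_def T_def)
    finally show ?thesis .
  qed
  then show "Phi r q < 1"
    using Phi_eq_polygamma[OF r] by (simp add: S_def T_def x_def)
next
  fix r :: real
  assume r: "r > 2/3"
  show "Phi r (2/3) > 1"
    using polygamma_parabola_greater_1[of "r + 1 - 2/3"] Phi_eq_polygamma[OF r] r by simp
qed

end
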